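(* Let $x_0\in\mathbb R^3$, $t_0\in\mathbb R$, $r>0$, $0<\rho\le\frac14$, $0<\ell\le\rho r$. Let $u\in L^\infty(I_r;L^2(\mathbb R^3;\mathbb R^3))$ satisfy $\operatorname{div}u=0$, and let $\chi\in C_c^\infty(Q_r)$ with $0\le\chi\le1$. With the filtered quantities defined in the context, the positive near-field stretching is bounded by the pairwise direction defect: $$\mathcal V_{r,\ell}^{+,\mathrm{near}}[\chi]\le\frac{3}{8\pi}\,\mathcal A_{r,\ell}^{\mathrm{pair}}[\chi],$$ where the right-hand side is allowed to be $+\infty$ (in which case the inequality is trivial).
   Context: Notation: $B_r=B_r(x_0)\subset\mathbb R^3$, $I_r=(t_0-r^2,t_0)$, $Q_r=B_r\times I_r$. Filter: $\varphi\in C_c^\infty(B_1(0))$, $\varphi\ge0$, $\int\varphi=1$, $\varphi_\ell(x)=\ell^{-3}\varphi(x/\ell)$. Set $U_\ell=\varphi_\ell*u$ (convolution in space), $\Omega_\ell=\operatorname{curl}U_\ell$, and the filtered direction $\xi_\ell=\Omega_\ell/|\Omega_\ell|$ where $\Omega_\ell\neq0$, $\xi_\ell=0$ where $\Omega_\ell=0$. Kernel cutoff: $\vartheta\in C_c^\infty(B_1(0))$ is radial, $0\le\vartheta\le1$, $\vartheta\equiv1$ on $B_{1/2}(0)$. Near-field strain (with $\widehat z=z/|z|$): $$\mathbb S_\ell^{\mathrm{near}}(x,t)=\frac{3}{8\pi}\,\mathrm{p.v.}\!\int_{\mathbb R^3}\vartheta\!\left(\frac z{\rho r}\right)\frac{(\widehat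 z\times\Omega_\ell(x-z,t))\otimes\widehat z+\widehat z\otimes(\widehat z\times\Omega_\ell(x-z,t))}{|z|^3}\,dz .$$ Positive near-field stretching: $$\mathcal V_{r,\ell}^{+,\mathrm{near}}[\chi]=r\iint_{Q_r}\chi\,\bigl(\mathbb S_\ell^{\mathrm{near}}\Omega_\ell\cdot\Omega_\ell\bigr)_+\,dx\,dt .$$ Pairwise direction defect (inner integral interpreted by monotone truncation at $|z|=\delta$, $\delta\downarrow0$; values in $[0,\infty]$): $$\mathcal A_{r,\ell}^{\mathrm{pair}}[\chi]=r\iint_{Q_r}\chi(x,t)|\Omega_\ell(x,t)|^2\int_{\mathbb R^3}\vartheta\!\left(\frac z{\rho r}\right)\frac{|\xi_\ell(x,t)-\xi_\ell(x-z,t)|\,|\Omega_\ell(x-z,t)|}{|z|^3}\,dz\,dx\,dt .$$ *)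

theory Defs
  imports "HOL-Analysis.Analysis"
begin

primrec C_k :: "nat \<Rightarrow> ('a::euclidean_space \<Rightarrow> real) \<Rightarrow> bool" where
  "C_k 0 f \<longleftrightarrow> continuous_on UNIV f"
| "C_k (Suc k) f \<longleftrightarrow>
     (\<forall>x. f differentiable (at x)) \<and>
     (\<forall>b\<in>Basis. C_k k (\<lambda>x. frechet_derivative f (at x) b))"

definition C_infinity :: "('a::euclidean_space \<Rightarrow> real) \<Rightarrow> bool" where
  "C_infinity f \<longleftrightarrow> (\<forall>k. C_k k f)"

text \<open>Elements of \<open>C\<^sub>c\<^sup>\<infinity>(S)\<close>, extended by zero to the whole space.\<close>

definition test_function :: "('a::euclidean_space \<Rightarrow> real) \<Rightarrow> 'a set \<Rightarrow> bool" where
  "test_function f S \<longleftrightarrow>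
     C_infinity f \<and> compact (closure {x. f x \<noteq> 0}) \<and> closure {x. f x \<noteq> 0} \<subseteq> S"

text \<open>
  Representatives of elements of \<open>L\<^sup>\<infinity>(I; L\<^sup>2(\<real>\<^sup>3; \<real>\<^sup>3))\<close>.  Since \<open>L\<^sup>2\<close> is separable, the strongly
  measurable maps into it are those given by jointly (Lebesgue) measurable functions on space-time.
\<close>

definition Linf_L2 :: "real set \<Rightarrow> (real^3 \<Rightarrow> real \<Rightarrow> real^3) \<Rightarrow> bool" where
  "Linf_L2 I u \<longleftrightarrow>
     (\<lambda>p. u (fst p) (snd p)) \<in> borel_measurable (lebesgue_on (UNIV \<times> I)) \<and>
     (\<exists>C::real. AE t in lebesgue_on I.
        (\<lambda>x. u x t) \<in> borel_measurable lebesgue \<and>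
        (\<integral>\<^sup>+ x. ennreal ((norm (u x t))\<^sup>2) \<partial>lebesgue) \<le> ennreal (C\<^sup>2))"

text \<open>
  Distributional \<open>div v = 0\<close>: the integrand is \<open>v \<bullet> \<nabla>\<psi>\<close>, i.e. the derivative of \<open>\<psi>\<close> in direction \<open>v\<close>.
\<close>

definition weakly_div_free :: "(real^3 \<Rightarrow> real^3) \<Rightarrow> bool" where
  "weakly_div_free v \<longleftrightarrow>
     (\<forall>\<psi>. test_function \<psi> UNIV \<longrightarrow>
        (\<integral>x. frechet_derivative \<psi> (at x) (v x) \<partial>lebesgue) = 0)"

definition partial_deriv :: "3 \<Rightarrow> (real^3 \<Rightarrow> real^3) \<Rightarrow> real^3 \<Rightarrow> real^3" where
  "partial_deriv j F x = frechet_derivative F (at x) (axis j 1)"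

definition curl :: "(real^3 \<Rightarrow> real^3) \<Rightarrow> real^3 \<Rightarrow> real^3" where
  "curl F x = vector [partial_deriv 2 F x $ 3 - partial_deriv 3 F x $ 2,
                      partial_deriv 3 F x $ 1 - partial_deriv 1 F x $ 3,
                      partial_deriv 1 F x $ 2 - partial_deriv 2 F x $ 1]"

definition tensor :: "real^3 \<Rightarrow> real^3 \<Rightarrow> real^3^3" (infixl "\<otimes>" 75) where
  "a \<otimes> b = (\<chi> i j. a $ i * b $ j)"

definition filter_kernel :: "(real^3 \<Rightarrow> real) \<Rightarrow> real \<Rightarrow> real^3 \<Rightarrow> real" where
  "filter_kernel \<phi> l x = \<phi> (x /\<^sub>R l) / l ^ 3"

definition filtered_velocity ::
  "(real^3 \<Rightarrow> real) \<Rightarrow> real \<Rightarrow> (real^3 \<Rightarrow> real \<Rightarrow> real^3) \<Rightarrow> real^3 \<Rightarrow> real \<Rightarrow> real^3" where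
  "filtered_velocity \<phi> l u x t = (\<integral>y. filter_kernel \<phi> l (x - y) *\<^sub>R u y t \<partial>lebesgue)"

definition filtered_vorticity ::
  "(real^3 \<Rightarrow> real) \<Rightarrow> real \<Rightarrow> (real^3 \<Rightarrow> real \<Rightarrow> real^3) \<Rightarrow> real^3 \<Rightarrow> real \<Rightarrow> real^3" where
  "filtered_vorticity \<phi> l u x t = curl (\<lambda>y. filtered_velocity \<phi> l u y t) x"

text \<open>Recall that \<open>sgn v = v / |v|\<close> for \<open>v \<noteq> 0\<close> and \<open>sgn 0 = 0\<close>.\<close>

definition filtered_direction ::
  "(real^3 \<Rightarrow> real) \<Rightarrow> real \<Rightarrow> (real^3 \<Rightarrow> real \<Rightarrow> real^3) \<Rightarrow> real^3 \<Rightarrow> real \<Rightarrow> real^3" where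
  "filtered_direction \<phi> l u x t = sgn (filtered_vorticity \<phi> l u x t)"

text \<open>
  Below, \<open>w\<close> and \<open>\<xi>\<close> stand for the filtered vorticity and its direction, and
  \<open>R = \<rho> r\<close> is the radius of the kernel cutoff.
\<close>

definition near_strain ::
  "(real^3 \<Rightarrow> real) \<Rightarrow> real \<Rightarrow> (real^3 \<Rightarrow> real \<Rightarrow> real^3) \<Rightarrow> real^3 \<Rightarrow> real \<Rightarrow> real^3^3" where
  "near_strain \<theta> R w x t =
     (3 / (8 * pi)) *\<^sub>R
     Lim (at_right 0) (\<lambda>\<delta>::real.
       \<integral>z\<in>{z. \<delta> < norm z}.
         (\<theta> (z /\<^sub>R R) / norm z ^ 3) *\<^sub>R
           (cross3 (sgn z) (w (x - z) t) \<otimes> sgn z + sgn z \<otimes> cross3 (sgn z) (w (x - z) t)) \<partial>lborel)"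

definition parabolic_cylinder :: "real^3 \<Rightarrow> real \<Rightarrow> real \<Rightarrow> ((real^3) \<times> real) set" where
  "parabolic_cylinder x0 t0 r = ball x0 r \<times> {t0 - r\<^sup>2 <..< t0}"

definition near_stretching_pos ::
  "(real^3 \<Rightarrow> real) \<Rightarrow> real \<Rightarrow> real^3 \<Rightarrow> real \<Rightarrow> real \<Rightarrow>
   (real^3 \<Rightarrow> real \<Rightarrow> real^3) \<Rightarrow> ((real^3) \<times> real \<Rightarrow> real) \<Rightarrow> ennreal" where
  "near_stretching_pos \<theta> \<rho> x0 t0 r w chi =
     ennreal r * (\<integral>\<^sup>+ (x, t) \<in> parabolic_cylinder x0 t0 r.
       ennreal (chi (x, t) * max 0 ((near_strain \<theta> (\<rho> * r) w x t *v w x t) \<bullet> w x t)) \<partial>lborel)"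

text \<open>The supremum over \<open>\<delta> > 0\<close> is the monotone limit as \<open>\<delta>\<close> decreases to \<open>0\<close>.\<close>

definition pair_integral ::
  "(real^3 \<Rightarrow> real) \<Rightarrow> real \<Rightarrow> (real^3 \<Rightarrow> real \<Rightarrow> real^3) \<Rightarrow> (real^3 \<Rightarrow> real \<Rightarrow> real^3) \<Rightarrow>
   real^3 \<Rightarrow> real \<Rightarrow> ennreal" where
  "pair_integral \<theta> R w \<xi> x t =
     (SUP \<delta>\<in>{0::real<..}. \<integral>\<^sup>+ z \<in> {z. \<delta> < norm z}.
       ennreal (\<theta> (z /\<^sub>R R) * (norm (\<xi> x t - \<xi> (x - z) t) * norm (w (x - z) t)) / norm z ^ 3)
       \<partial>lborel)"

definition pair_defect ::
  "(real^3 \<Rightarrow> real) \<Rightarrow> real \<Rightarrow> real^3 \<Rightarrow> real \<Rightarrow> real \<Rightarrow>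
   (real^3 \<Rightarrow> real \<Rightarrow> real^3) \<Rightarrow> (real^3 \<Rightarrow> real \<Rightarrow> real^3) \<Rightarrow> ((real^3) \<times> real \<Rightarrow> real) \<Rightarrow> ennreal" where
  "pair_defect \<theta> \<rho> x0 t0 r w \<xi> chi =
     ennreal r * (\<integral>\<^sup>+ (x, t) \<in> parabolic_cylinder x0 t0 r.
       ennreal (chi (x, t) * (norm (w x t))\<^sup>2) * pair_integral \<theta> (\<rho> * r) w \<xi> x t \<partial>lborel)"

end

theory Submission
  imports Defs
begin

text \<open>
  Write \<open>p = w(x)\<close>, \<open>s = z / |z|\<close> and \<open>a = w(x - z)\<close>.  The quadratic form of the strain kernel at \<open>p\<close> is
  \<open>2 (s \<bullet> p) ((s \<times> a) \<bullet> p)\<close>.  In the triple product \<open>a\<close> may be replaced by \<open>|a| (sgn a - sgn p)\<close>, since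
  the component along \<open>p\<close> contributes nothing, and \<open>2 |s \<bullet> p| |p \<times> s| \<le> (s \<bullet> p)\<^sup>2 + |p \<times> s|\<^sup>2 = |p|\<^sup>2\<close>
  absorbs the factor 2.  So every truncated integral is bounded by the truncated pair integral.
  The principal value exists because \<open>w\<close> is differentiable in space for almost every time and the
  kernel has mean zero on spheres: subtracting \<open>w(x)\<close> leaves an integrand of order \<open>|z|\<^sup>-\<^sup>2\<close>.
\<close>

section \<open>Integration on Euclidean space\<close>

text \<open>Replaces \<open>nn_integral_cmult\<close> where measurability of the pair integral would have to be shown.\<close>

lemma nn_integral_cmult_le:
  fixes c :: real
  assumes "0 < c"
  shows "(\<integral>\<^sup>+x. ennreal c * f x \<partial>M) \<le> ennreal c * (\<integral>\<^sup>+x. f x \<partial>M)"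
  unfolding nn_integral_def[of M "\<lambda>x. ennreal c * f x"]
proof (rule SUP_least, clarsimp)
  fix g assume g: "simple_function M g" "g \<le> (\<lambda>x. ennreal c * f x)"
  \<comment> \<open>Scaling by \<open>1 / c\<close> turns a simple function below
    \<open>c * f\<close> into one below \<open>f\<close>, so the suprema defining the two integrals
    can be compared directly.\<close>
  define h where "h = (\<lambda>x. ennreal (1 / c) * g x)"
  have "ennreal c * ennreal (1/c) = 1"
    using assms by (simp flip: ennreal_mult)
  hence c: "ennreal (1/c) * (ennreal c * y) = y" "ennreal c * (ennreal (1/c) * y) = y" for y
    by (metis mult.assoc mult.commute mult_1)+
  have h: "simple_function M h"
    unfolding h_def using g(1) by (intro simple_function_mult simple_function_const)
  have "h x \<le> f x" for x
    using mult_left_mono[OF le_funD[OF g(2), of x], of "ennreal (1/c)"]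
    by (simp add: c h_def)
  then have "integral\<^sup>N M h \<le> integral\<^sup>N M f"
    by (intro nn_integral_mono)
  moreover have "integral\<^sup>S M g = ennreal c * integral\<^sup>N M h"
    using h g(1) c by (simp add: h_def nn_integral_cmult nn_integral_eq_simple_integral
        borel_measurable_simple_function flip: nn_integral_eq_simple_integral)
  ultimately show "integral\<^sup>S M g \<le> ennreal c * integral\<^sup>N M f"
    by (simp add: mult_left_mono)
qed

text \<open>Boxes determine \<open>lborel\<close>, and orthogonal images keep their volume; a
  preimage under \<open>T\<close> is an image under the inverse, which is again orthogonal. This
  permits a reflection as a change of variables.\<close>

lemma distr_lborel_orthogonal:
  fixes T :: "real^'n::{finite,wellorder} \<Rightarrow> real^'n::_"
  assumes T: "orthogonal_transformation T"
  shows "distr lborel borel T = lborel"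
proof (rule lborel_eqI[symmetric])
  have [measurable]: "T \<in> borel_measurable borel"
    using orthogonal_transformation_linear[OF T]
    by (intro borel_measurable_continuous_onI linear_continuous_on) (simp add: linear_conv_bounded_linear)
  fix a b :: "real^'n::{finite,wellorder}" assume ab: "\<And>i. i \<in> Basis \<Longrightarrow> a \<bullet> i \<le> b \<bullet> i"
  have vim: "T -` box a b = inv T ` box a b"
    using orthogonal_transformation_bij[OF T] by (simp add: bij_vimage_eq_inv_image)
  have m: "inv T ` box a b \<in> lmeasurable" "measure lebesgue (inv T ` box a b) = measure lebesgue (box a b)"
    using measurable_orthogonal_image[OF orthogonal_transformation_inv[OF T], of "box a b"]
      measure_orthogonal_image[OF orthogonal_transformation_inv[OF T], of "box a b"] by auto
  have "emeasure (distr lborel borel T) (box a b) = emeasure lborel (T -` box a b)"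
    by (subst emeasure_distr) auto
  also have "\<dots> = emeasure lebesgue (T -` box a b)"
    using measurable_sets[of T borel borel "box a b"] by simp
  also have "\<dots> = ennreal (measure lebesgue (box a b))"
    using m vim by (simp add: emeasure_eq_measure2)
  also have "\<dots> = ennreal (\<Prod>i\<in>Basis. (b - a) \<bullet> i)"
    using ab by (simp add: measure_lborel_box_eq)
  finally show "emeasure (distr lborel borel T) (box a b) = ennreal (\<Prod>i\<in>Basis. (b - a) \<bullet> i)" .
qed simp

text \<open>Dyadic decomposition: where \<open>r (Suc n) < norm z <= r n\<close>, the integrand is
  at most \<open>c n\<close>, and the ball of radius \<open>r n\<close> has volume proportional to
  \<open>r n ^ d\<close>. The products form a geometric series with ratio
  \<open>2 ^ k / 2 ^ d\<close>, which is below 1 because \<open>k < d\<close>.\<close>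

lemma integrable_norm_power_cball:
  fixes R :: real
  assumes k: "k < DIM('a::euclidean_space)" and R: "0 < R"
  shows "integrable lborel (\<lambda>z::'a. indicator (cball 0 R) z / norm z ^ k)"
proof (rule integrableI_nonneg)
  have cb [measurable]: "cball (0::'a) x \<in> sets lborel" for x by (simp add: borel_closed)
  show "(\<lambda>z::'a. indicator (cball 0 R) z / norm z ^ k) \<in> borel_measurable lborel" by measurable
  define d where "d = DIM('a)"
  define c where "c n = (2 ^ Suc n / R) ^ k" for n
  define r where "r n = R / 2 ^ n" for n
  \<comment> \<open>The origin lies in no dyadic shell; it is discarded later as a null set.\<close>
  have pt: "ennreal (indicator (cball 0 R) z / norm z ^ k)
      \<le> (\<Sum>n. ennreal (c n) * indicator (cball 0 (r n)) z)" (is "?l \<le> (\<Sum>n. ?s n)") if "z \<noteq> 0" for z :: 'a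
  proof (cases "norm z \<le> R")
    case True
    have ex: "\<exists>n. r n < norm z"
      using that R real_arch_pow_inv[of "norm z / R" "1/2"] 
      by (auto simp: r_def field_simps power_one_over)
    define m where "m = (LEAST n. r n < norm z)"
    have m: "r m < norm z" unfolding m_def using ex by (rule LeastI_ex)
    with True have "m \<noteq> 0" by (auto simp: r_def intro!: gr0I)
    then obtain n where n: "m = Suc n" by (cases m) auto
    have "norm z \<le> r n" using not_less_Least[of n "\<lambda>n. r n < norm z"] n m_def by force
    moreover have "1 / norm z ^ k \<le> c n"
    proof -
      have "1 / norm z \<le> 2 ^ Suc n / R"
        using m R that by (simp add: n r_def field_simps)
      then have "(1 / norm z) ^ k \<le> c n" unfolding c_def by (intro power_mono) auto
      then show ?thesis by (simp add: power_one_over)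
    qed
    ultimately have "?l \<le> ?s n" using True by (simp add: ennreal_leI)
    also have "\<dots> \<le> (\<Sum>n. ?s n)"
    proof -
      have "sum s {n} \<le> suminf s" for s :: "nat \<Rightarrow> ennreal" by (rule sum_le_suminf) auto
      then show ?thesis by simp
    qed
    finally show ?thesis .
  qed simp
  define V where "V = unit_ball_vol (real d)"
  have meas: "emeasure lborel (cball (0::'a) (r n)) = ennreal (r n ^ d * V)" for n
    using R by (simp add: V_def d_def r_def emeasure_cball mult.commute)
  have V: "V \<ge> 0" by (simp add: V_def)
  have sm: "summable (\<lambda>n. c n * (r n ^ d * V))"
  proof -
    have "c n * (r n ^ d * V) = (2 / R) ^ k * R ^ d * V * (2 ^ k / 2 ^ d) ^ n" for n
      using R by (simp add: c_def r_def power_divide power_mult_distrib field_simps flip: power_mult)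
    moreover have "(2::real) ^ k / 2 ^ d < 1" using k by (simp add: d_def)
    ultimately show ?thesis by (simp only:) (intro summable_mult summable_geometric; simp)
  qed
  have "(\<integral>\<^sup>+z. ennreal (indicator (cball 0 R) (z::'a) / norm z ^ k) \<partial>lborel)
     \<le> (\<integral>\<^sup>+z. (\<Sum>n. ennreal (c n) * indicator (cball (0::'a) (r n)) z) \<partial>lborel)"
    by (rule nn_integral_mono_AE) (use pt in \<open>auto intro!: AE_I[where N="{0}"]\<close>)
  also have "\<dots> = (\<Sum>n. ennreal (c n) * emeasure lborel (cball (0::'a) (r n)))"
    by (subst nn_integral_suminf, measurable) (simp only: nn_integral_cmult_indicator cb)
  also have "\<dots> = (\<Sum>n. ennreal (c n * (r n ^ d * V)))"
    using R by (simp add: meas c_def ennreal_mult' V)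
  also have "\<dots> < \<infinity>"
    using sm R V by (simp add: suminf_ennreal2 c_def r_def less_top)
  finally show "(\<integral>\<^sup>+z. ennreal (indicator (cball 0 R) (z::'a) / norm z ^ k) \<partial>lborel) < \<infinity>" .
qed auto

section \<open>Convolutions and the regularity of the filtered vorticity\<close>

text \<open>For fixed \<open>x\<close> the factor \<open>g (x - y)\<close> vanishes unless
  \<open>norm y <= norm x + R\<close>, so \<open>v\<close> may be cut off to a ball; there
  \<open>g\<close> is bounded by compactness.\<close>

lemma integrable_convolution:
  fixes g :: "'a::euclidean_space \<Rightarrow> real" and v :: "'a \<Rightarrow> 'b::euclidean_space"
  assumes cont: "continuous_on UNIV g"
    and supp: "\<And>x. R < norm x \<Longrightarrow> g x = 0"
    and v: "\<And>r. integrable lebesgue (\<lambda>y. indicator (cball 0 r) y *\<^sub>R v y)"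
  shows "integrable lebesgue (\<lambda>y. g (x - y) *\<^sub>R v y)"
proof -
  have "compact (g ` cball 0 R)"
    using cont by (intro compact_continuous_image) (auto intro: continuous_on_subset)
  then obtain B where B: "\<And>z. z \<in> cball 0 R \<Longrightarrow> norm (g z) \<le> B"
    by (metis bounded_iff compact_imp_bounded image_eqI)
  let ?w = "\<lambda>y. indicator (cball 0 (norm x + R)) y *\<^sub>R v y"
  have eq: "(\<lambda>y. g (x - y) *\<^sub>R v y) = (\<lambda>y. g (x - y) *\<^sub>R ?w y)"
  proof
    fix y
    have "norm y \<le> norm x + R" if "norm (x - y) \<le> R"
      using that norm_triangle_ineq4[of x "x - y"] by simp
    then show "g (x - y) *\<^sub>R v y = g (x - y) *\<^sub>R ?w y"
      using supp[of "x - y"] by (cases "R < norm (x - y)") auto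
  qed
  have [measurable]: "(\<lambda>y. g (x - y)) \<in> borel_measurable lebesgue"
    by (intro measurable_completion borel_measurable_continuous_on[OF cont, of "\<lambda>y. x - y", simplified o_def])
       auto
  have m: "(\<lambda>y. g (x - y) *\<^sub>R ?w y) \<in> borel_measurable lebesgue"
    by (intro borel_measurable_scaleR borel_measurable_integrable[OF v]) measurable
  \<comment> \<open>If \<open>R\<close> is negative, the ball is empty and says nothing about the
    sign of \<open>B\<close>; hence the absolute value.\<close>
  have "norm (g (x - y) *\<^sub>R ?w y) \<le> norm (\<bar>B\<bar> *\<^sub>R ?w y)" for y
    using B[of "x - y"] supp[of "x - y"]
    by (cases "R < norm (x - y)") (auto simp: abs_mult indicator_def intro!: mult_right_mono)
  then show ?thesis
    unfolding eq
    by (intro Bochner_Integration.integrable_bound[OF integrable_scaleR_right[OF v, of "\<bar>B\<bar>"] m] AE_I2) simp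
qed

text \<open>The gradient of \<open>g\<close> is continuous with compact support, hence uniformly
  continuous. The first-order Taylor remainder of \<open>g\<close> is therefore small relative to
  \<open>norm h\<close>, uniformly in the base point, and can be integrated against \<open>v\<close>
  over a single ball.\<close>

lemma has_derivative_convolution:
  fixes g :: "'a::euclidean_space \<Rightarrow> real" and v :: "'a \<Rightarrow> 'b::euclidean_space"
  assumes g': "\<And>x. (g has_derivative g' x) (at x)"
    and cont: "\<And>b. b \<in> Basis \<Longrightarrow> continuous_on UNIV (\<lambda>x. g' x b)"
    and supp: "\<And>x. R < norm x \<Longrightarrow> g x = 0"
    and v: "\<And>r. integrable lebesgue (\<lambda>y. indicator (cball 0 r) y *\<^sub>R v y)"
  shows "((\<lambda>x. \<integral>y. g (x - y) *\<^sub>R v y \<partial>lebesgue) has_derivative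
          (\<lambda>h. \<integral>y. g' (x - y) h *\<^sub>R v y \<partial>lebesgue)) (at x)"
proof -
  \<comment> \<open>Passing to the gradient vector reduces uniform continuity of the family of
    linear maps \<open>g' z\<close> to that of one vector field.\<close>
  define G where "G z = (\<Sum>b\<in>Basis. g' z b *\<^sub>R b)" for z
  have lin: "linear (g' z)" for z
    using g' has_derivative_linear by blast
  have G: "g' z h = G z \<bullet> h" for z h
  proof -
    have "g' z h = g' z (\<Sum>b\<in>Basis. (h \<bullet> b) *\<^sub>R b)" by (simp add: euclidean_representation)
    also have "\<dots> = (\<Sum>b\<in>Basis. (h \<bullet> b) * g' z b)"
      by (simp add: linear_sum[OF lin] linear_scale[OF lin])
    finally show ?thesis by (simp add: G_def inner_sum_left inner_commute[of h] mult.commute)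
  qed
  have contG: "continuous_on UNIV G"
    unfolding G_def[abs_def] using cont by (intro continuous_intros) auto
  have suppg': "g' z h = 0" if "R < norm z" for z h
  proof -
    have "open {z. R < norm (z::'a)}" by (intro open_Collect_less continuous_intros)
    with g'[of z] have "((\<lambda>_. 0) has_derivative g' z) (at z)"
      using that supp by (auto intro: has_derivative_transform_within_open)
    then show ?thesis using has_derivative_unique[OF has_derivative_const] by (metis)
  qed
  have suppG: "G z = 0" if "R < norm z" for z
    using suppg'[OF that] by (simp add: G_def)
  \<comment> \<open>Points less than 1 apart either both lie in the ball of radius
    \<open>R + 1\<close>, where compactness applies, or both lie outside the ball of radius
    \<open>R\<close>, where \<open>G\<close> vanishes.\<close>
  have uc: "\<exists>d>0. \<forall>z z'. norm (z' - z) < d \<longrightarrow> norm (G z' - G z) \<le> e" if "e > 0" for e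
  proof -
    have "uniformly_continuous_on (cball 0 (R + 1)) G"
      by (intro compact_uniformly_continuous) (auto intro: continuous_on_subset[OF contG])
    then obtain d where d: "d > 0" "\<And>z z'. norm z \<le> R + 1 \<Longrightarrow> norm z' \<le> R + 1 \<Longrightarrow>
        norm (z' - z) < d \<Longrightarrow> norm (G z' - G z) < e"
      using \<open>e > 0\<close> by (fastforce simp: uniformly_continuous_on_def dist_norm)
    have "norm (G z' - G z) \<le> e" if zz: "norm (z' - z) < min d 1" for z z'
    proof (cases "norm z \<le> R + 1 \<and> norm z' \<le> R + 1")
      case True
      then show ?thesis using d(2)[of z z'] zz by auto
    next
      case False
      then have "R < norm z" "R < norm z'"
        using zz norm_triangle_ineq2[of z z'] norm_triangle_ineq2[of z' z] by (auto simp: norm_minus_commute)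
      then show ?thesis using suppG \<open>e > 0\<close> by simp
    qed
    then show ?thesis using d(1) by (intro exI[of _ "min d 1"]) auto
  qed
  have taylor: "\<exists>d>0. \<forall>z h. norm h < d \<longrightarrow> \<bar>g (z + h) - g z - g' z h\<bar> \<le> e * norm h" if "e > 0" for e
  proof -
    obtain d where d: "d > 0" "\<And>z z'. norm (z' - z) < d \<Longrightarrow> norm (G z' - G z) \<le> e"
      using uc[OF \<open>e > 0\<close>] by blast
    have "\<bar>g (z + h) - g z - g' z h\<bar> \<le> e * norm h" if h: "norm h < d" for z h
    proof -
      have "norm (g (z + h) - g z - g' z (z + h - z)) \<le> norm (z + h - z) * e"
      proof (rule differentiable_bound_linearization[where S = "ball z d"])
        show "z + t *\<^sub>R (z + h - z) \<in> ball z d" if "t \<in> {0..1}" for t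
        proof -
          have "\<bar>t\<bar> * norm h \<le> 1 * norm h" using that by (intro mult_right_mono) auto
          then show ?thesis using h by (simp add: dist_norm)
        qed
        show "(g has_derivative g' y) (at y within ball z d)" for y
          using g' has_derivative_at_withinI by blast
        show "onorm (g' y - g' z) \<le> e" if "y \<in> ball z d" for y
        proof (rule onorm_le)
          fix k
          have "norm ((g' y - g' z) k) = \<bar>(G y - G z) \<bullet> k\<bar>" by (simp add: G inner_diff_left)
          also have "\<dots> \<le> norm (G y - G z) * norm k" by (rule Cauchy_Schwarz_ineq2)
          also have "\<dots> \<le> e * norm k"
            using that by (intro mult_right_mono d(2)) (auto simp: dist_norm norm_minus_commute)
          finally show "norm ((g' y - g' z) k) \<le> e * norm k" .
        qed
      qed (use d in auto)
      then show ?thesis by (simp add: mult.commute)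
    qed
    then show ?thesis using d(1) by blast
  qed
  have contg: "continuous_on UNIV g"
    using g' by (intro continuous_at_imp_continuous_on) (auto intro: has_derivative_continuous)
  have ig: "integrable lebesgue (\<lambda>y. g (x - y) *\<^sub>R v y)" for x
    by (rule integrable_convolution[OF contg supp v])
  have ig': "integrable lebesgue (\<lambda>y. g' (x - y) h *\<^sub>R v y)" for x h
  proof (rule integrable_convolution[OF _ _ v])
    show "continuous_on UNIV (\<lambda>z. g' z h)"
      unfolding G by (intro continuous_intros contG)
  qed (rule suppg')
  define L where "L h = (\<integral>y. g' (x - y) h *\<^sub>R v y \<partial>lebesgue)" for h
  have "linear L"
    unfolding L_def
    by (intro linearI) (simp_all add: linear_add[OF lin] linear_scale[OF lin] scaleR_add_left ig'
         flip: scaleR_scaleR)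
  define F where "F x = (\<integral>y. g (x - y) *\<^sub>R v y \<partial>lebesgue)" for x
  \<comment> \<open>The extra 1 makes one ball serve for all \<open>x'\<close> within distance 1 of
    \<open>x\<close>.\<close>
  define r where "r = norm x + R + 1"
  define N where "N = (\<integral>y. norm (indicator (cball 0 r) y *\<^sub>R v y) \<partial>lebesgue)"
  have "N \<ge> 0" by (simp add: N_def)
  have "(F has_derivative L) (at x)"
    unfolding has_derivative_at_alt
  proof (intro conjI allI impI)
    show "bounded_linear L" using \<open>linear L\<close> linear_conv_bounded_linear by blast
    fix e :: real assume "e > 0"
    \<comment> \<open>The remainder gets multiplied by \<open>N\<close>, which may be 0; dividing by
      \<open>N + 1\<close> stays safe.\<close>
    then have "e / (N + 1) > 0" using \<open>N \<ge> 0\<close> by simp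
    from taylor[OF this] obtain d where d: "d > 0"
      "\<And>z h. norm h < d \<Longrightarrow> \<bar>g (z + h) - g z - g' z h\<bar> \<le> e / (N + 1) * norm h" by blast
    show "\<exists>d>0. \<forall>y. norm (y - x) < d \<longrightarrow> norm (F y - F x - L (y - x)) \<le> e * norm (y - x)"
    proof (intro exI[of _ "min d 1"] conjI allI impI)
      fix x' assume x': "norm (x' - x) < min d 1"
      define h where "h = x' - x"
      let ?D = "\<lambda>y. g (x' - y) - g (x - y) - g' (x - y) h"
      have "F x' - F x - L h = (\<integral>y. ?D y *\<^sub>R v y \<partial>lebesgue)"
        by (simp add: F_def L_def ig ig' scaleR_diff_left)
      also have "norm \<dots> \<le> (\<integral>y. norm (?D y *\<^sub>R v y) \<partial>lebesgue)"
        by (rule integral_norm_bound)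
      also have "\<dots> \<le> (\<integral>y. (e / (N + 1) * norm h) * norm (indicator (cball 0 r) y *\<^sub>R v y) \<partial>lebesgue)"
      proof (rule integral_mono)
        show "integrable lebesgue (\<lambda>y. norm (?D y *\<^sub>R v y))"
          unfolding scaleR_diff_left by (intro integrable_norm Bochner_Integration.integrable_diff ig ig')
        show "integrable lebesgue (\<lambda>y. (e / (N + 1) * norm h) * norm (indicator (cball 0 r) y *\<^sub>R v y))"
          by (intro integrable_mult_right integrable_norm v)
        fix y
        show "norm (?D y *\<^sub>R v y) \<le> (e / (N + 1) * norm h) * norm (indicator (cball 0 r) y *\<^sub>R v y)"
        proof (cases "norm y \<le> r")
          case True
          have "x' - y = x - y + h" by (simp add: h_def)
          then have "\<bar>?D y\<bar> \<le> e / (N + 1) * norm h" using d(2)[of h "x - y"] x' by (simp add: h_def)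
          then have "\<bar>?D y\<bar> * norm (v y) \<le> e / (N + 1) * norm h * norm (v y)"
            by (rule mult_right_mono) simp
          then show ?thesis using True by simp
        next
          case False
          then have "R < norm (x - y)" "R < norm (x' - y)"
            using x' norm_triangle_ineq2[of y x] norm_triangle_ineq2[of y x'] norm_triangle_ineq2[of x' x]
            by (auto simp: r_def norm_minus_commute)
          then show ?thesis using supp suppg' False by simp
        qed
      qed
      also have "\<dots> = (e / (N + 1) * norm h) * N"
        unfolding N_def by (rule integral_mult_right_zero)
      also have "\<dots> \<le> e * norm h"
        using \<open>N \<ge> 0\<close> \<open>e > 0\<close> by (simp add: field_simps mult_left_mono)
      finally show "norm (F x' - F x - L (x' - x)) \<le> e * norm (x' - x)" by (simp add: h_def)
    qed (use d(1) in auto)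
  qed
  then show ?thesis by (simp add: F_def[abs_def] L_def[abs_def])
qed

text \<open>The chain rule contributes the factor \<open>1 / l\<close>. The constant
  \<open>c\<close> is left free because the lemma is applied twice: to the filter with
  \<open>c = 1 / l ^ 3\<close>, and to its partial derivatives with one more power of
  \<open>1 / l\<close>.\<close>

lemma C_k_1_has_derivative_convolution:
  fixes \<psi> :: "'a::euclidean_space \<Rightarrow> real" and v :: "'a \<Rightarrow> 'b::euclidean_space"
  assumes \<psi>: "C_k (Suc 0) \<psi>" and supp: "\<And>x. 1 < norm x \<Longrightarrow> \<psi> x = 0" and l: "0 < l"
    and v: "\<And>r. integrable lebesgue (\<lambda>y. indicator (cball 0 r) y *\<^sub>R v y)"
  shows "((\<lambda>x. \<integral>y. (c * \<psi> ((x - y) /\<^sub>R l)) *\<^sub>R v y \<partial>lebesgue) has_derivative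
          (\<lambda>h. \<integral>y. (c / l * frechet_derivative \<psi> (at ((x - y) /\<^sub>R l)) h) *\<^sub>R v y \<partial>lebesgue)) (at x)"
proof (rule has_derivative_convolution[where g = "\<lambda>x. c * \<psi> (x /\<^sub>R l)" and R = l, OF _ _ _ v])
  have d: "(\<psi> has_derivative frechet_derivative \<psi> (at z)) (at z)" for z
    using \<psi> by (simp add: frechet_derivative_works)
  have lin: "frechet_derivative \<psi> (at z) (a *\<^sub>R h) = a * frechet_derivative \<psi> (at z) h" for z a h
    using linear_scale[OF has_derivative_linear[OF d]] by simp
  show "((\<lambda>x. c * \<psi> (x /\<^sub>R l)) has_derivative
        (\<lambda>h. c / l * frechet_derivative \<psi> (at (x /\<^sub>R l)) h)) (at x)" for x
  proof -
    have "((\<lambda>x. c * \<psi> (x /\<^sub>R l)) has_derivative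
        (\<lambda>h. c * frechet_derivative \<psi> (at (x /\<^sub>R l)) (h /\<^sub>R l))) (at x)"
      by (intro has_derivative_mult_right has_derivative_compose[OF _ d]
          has_derivative_scaleR_right has_derivative_ident)
    then show ?thesis by (simp only: lin divide_inverse mult.assoc)
  qed
  show "continuous_on UNIV (\<lambda>x. c / l * frechet_derivative \<psi> (at (x /\<^sub>R l)) b)" if "b \<in> Basis" for b
  proof -
    have "continuous_on UNIV (\<lambda>z. frechet_derivative \<psi> (at z) b)" using \<psi> that by simp
    then have "continuous_on UNIV (\<lambda>x. frechet_derivative \<psi> (at (x /\<^sub>R l)) b)"
      by (rule continuous_on_compose2) (auto intro!: continuous_on_scaleR continuous_on_const continuous_on_id)
    then show ?thesis by (rule continuous_on_mult_left)
  qed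
  show "c * \<psi> (x /\<^sub>R l) = 0" if "l < norm x" for x
    using supp[of "x /\<^sub>R l"] that l by (simp add: field_simps)
qed

text \<open>In this form the curl is a sum of fixed linear images of the partial derivatives, so
  differentiability passes from them to the curl.\<close>

lemma curl_eq_sum_cross:
  "curl F x = (\<Sum>j\<in>UNIV. cross3 (axis j 1) (partial_deriv j F x))"
  by (simp add: curl_def sum_3 cross3_def vec_eq_iff forall_3 axis_def)

text \<open>All derivatives fall on the filter: each partial derivative of the filtered velocity is
  a convolution with a partial derivative of \<open>\<phi>\<close>, which is itself C^1 with support
  in the unit ball, so it can be differentiated once more.\<close>

lemma differentiable_filtered_vorticity:
  assumes \<phi>: "test_function \<phi> (ball 0 1)" and l: "0 < l"
    and v: "\<And>r. integrable lebesgue (\<lambda>y. indicator (cball 0 r) y *\<^sub>R u y t)"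
  shows "(\<lambda>x. filtered_vorticity \<phi> l u x t) differentiable (at x)"
proof -
  have C2: "C_k (Suc (Suc 0)) \<phi>" and C1: "C_k (Suc 0) \<phi>"
    using \<phi> unfolding test_function_def C_infinity_def by blast+
  have supp: "\<phi> x = 0" if "1 < norm x" for x
    using \<phi> closure_subset[of "{x. \<phi> x \<noteq> 0}"] that unfolding test_function_def by force
  define \<psi> where "\<psi> j x = frechet_derivative \<phi> (at x) (axis j 1)" for j :: 3 and x
  have C\<psi>: "C_k (Suc 0) (\<psi> j)" for j
    using C2 unfolding \<psi>_def[abs_def] C_k.simps(2)[of "Suc 0"]
    by (metis axis_in_Basis_iff Basis_real_def insertI1)
  have supp\<psi>: "\<psi> j x = 0" if "1 < norm x" for j x
  proof -
    have "(\<phi> has_derivative frechet_derivative \<phi> (at x)) (at x)"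
      using C1 by (simp add: frechet_derivative_works)
    moreover have "open {z. 1 < norm (z::real^3)}" by (intro open_Collect_less continuous_intros)
    ultimately have "((\<lambda>_. 0) has_derivative frechet_derivative \<phi> (at x)) (at x)"
      using that supp by (auto intro: has_derivative_transform_within_open)
    then show ?thesis using has_derivative_unique[OF has_derivative_const] by (metis \<psi>_def)
  qed
  have U: "filtered_velocity \<phi> l u x t = (\<integral>y. ((1 / l ^ 3) * \<phi> ((x - y) /\<^sub>R l)) *\<^sub>R u y t \<partial>lebesgue)" for x
    by (simp add: filtered_velocity_def filter_kernel_def)
  define P where "P j x = (\<integral>y. ((1 / l ^ 3) / l * \<psi> j ((x - y) /\<^sub>R l)) *\<^sub>R u y t \<partial>lebesgue)" for j x
  have P: "partial_deriv j (\<lambda>y. filtered_velocity \<phi> l u y t) x = P j x" for j x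
    unfolding partial_deriv_def U P_def \<psi>_def
    by (subst frechet_derivative_at[OF C_k_1_has_derivative_convolution[OF C1 supp l v], symmetric]) simp_all
  have "P j differentiable (at x)" for j
    unfolding P_def[abs_def]
    using C_k_1_has_derivative_convolution[OF C\<psi> supp\<psi> l v] by (rule differentiableI)
  then have "(\<lambda>x. cross3 (axis j 1) (P j x)) differentiable (at x)" for j
  proof -
    have "bounded_linear (cross3 (axis j 1))"
      using bilinear_cross by (simp add: bilinear_def linear_conv_bounded_linear)
    moreover obtain D where "(P j has_derivative D) (at x)"
      using \<open>\<And>j. P j differentiable (at x)\<close> unfolding differentiable_def by blast
    ultimately show ?thesis
      by (intro differentiableI) (rule bounded_linear.has_derivative)
  qed
  moreover have "filtered_vorticity \<phi> l u x t = (\<Sum>j\<in>UNIV. cross3 (axis j 1) (P j x))" for x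
    by (simp only: filtered_vorticity_def curl_eq_sum_cross P)
  ultimately show ?thesis
    by (simp only:) (rule differentiable_sum, auto)
qed

text \<open>On the ball, which has finite volume, \<open>norm (v y)\<close> is dominated by
  \<open>1 + (norm (v y))^2\<close>. This supplies the local integrability that the convolution
  lemmas require.\<close>

lemma square_integrable_imp_integrable_cball:
  fixes v :: "'a::euclidean_space \<Rightarrow> 'b::euclidean_space"
  assumes m: "v \<in> borel_measurable lebesgue"
    and fin: "(\<integral>\<^sup>+ x. ennreal ((norm (v x))\<^sup>2) \<partial>lebesgue) < \<infinity>"
  shows "integrable lebesgue (\<lambda>y. indicator (cball 0 r) y *\<^sub>R v y)"
proof (rule Bochner_Integration.integrable_bound)
  show "integrable lebesgue (\<lambda>y. indicator (cball 0 r) y + (norm (v y))\<^sup>2 :: real)"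
    using m fin emeasure_lborel_cball_finite[of "0::'a" r]
    by (intro Bochner_Integration.integrable_add integrable_real_indicator integrableI_nonneg) auto
  have "norm (v y) \<le> 1 + (norm (v y))\<^sup>2" for y
    using sum_squares_bound[of "norm (v y)" 1] norm_ge_zero[of "v y"]
    unfolding power_one mult_1_right by linarith
  then show "AE y in lebesgue. norm (indicator (cball 0 r) y *\<^sub>R v y)
      \<le> norm (indicator (cball 0 r) y + (norm (v y))\<^sup>2 :: real)"
    by (auto simp: indicator_def)
qed (intro borel_measurable_scaleR borel_measurable_indicator m, simp)

section \<open>Algebra of the strain kernel\<close>

text \<open>The tensor inside \<open>near_strain\<close> without its scalar weight; \<open>s\<close>
  stands for \<open>sgn z\<close> and \<open>a\<close> for the vorticity at
  \<open>x - z\<close>.\<close>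

definition strain_kernel :: "real^3 \<Rightarrow> real^3 \<Rightarrow> real^3^3" where
  "strain_kernel s a = cross3 s a \<otimes> s + s \<otimes> cross3 s a"

lemma norm_tensor: "norm (a \<otimes> b) = norm a * norm b"
proof -
  have row: "(a \<otimes> b) $ i = a $ i *\<^sub>R b" for i
    by (simp add: tensor_def vec_eq_iff)
  show ?thesis
    by (simp add: norm_vec_def[of "a \<otimes> b"] row norm_vec_def[of a] L2_set_left_distrib)
qed

lemma tensor_form: "((a \<otimes> b) *v p) \<bullet> q = (b \<bullet> p) * (a \<bullet> q)"
  by (simp add: tensor_def matrix_vector_mult_def inner_vec_def sum_3 algebra_simps)

text \<open>With two test vectors the symmetry in \<open>p\<close> and \<open>q\<close> is visible;
  the later polarization relies on it.\<close>

lemma strain_kernel_form: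
  "(strain_kernel s a *v p) \<bullet> q = (s \<bullet> p) * (cross3 s a \<bullet> q) + (cross3 s a \<bullet> p) * (s \<bullet> q)"
  by (simp add: strain_kernel_def matrix_vector_mult_add_rdistrib inner_add_left tensor_form)

lemma strain_kernel_diff: "strain_kernel s (a - b) = strain_kernel s a - strain_kernel s b"
  by (simp add: strain_kernel_def tensor_def vec_eq_iff cross3_simps)

lemma norm_cross_le: "norm (cross3 a b) \<le> norm a * norm b"
proof (rule power2_le_imp_le)
  show "(norm (cross3 a b))\<^sup>2 \<le> (norm a * norm b)\<^sup>2"
    using norm_cross_dot[of a b] zero_le_power2[of "a \<bullet> b"] by linarith
qed simp

text \<open>Assuming \<open>norm s <= 1\<close> instead of equality includes
  \<open>sgn 0 = 0\<close>.\<close>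

lemma norm_strain_kernel_le:
  assumes "norm s \<le> 1"
  shows "norm (strain_kernel s a) \<le> 2 * norm a"
proof -
  have "norm (cross3 s a) \<le> norm a"
    using norm_cross_le[of s a] mult_right_mono[OF assms, of "norm a"] by simp
  then have "norm (cross3 s a) * norm s \<le> norm a * 1"
    using assms by (intro mult_mono) auto
  then show ?thesis
    unfolding strain_kernel_def
    by (intro norm_triangle_le) (simp add: norm_tensor mult.commute)
qed

lemma continuous_on_strain_kernel:
  fixes f g :: "'a::t2_space \<Rightarrow> real^3"
  assumes "continuous_on S f" "continuous_on S g"
  shows "continuous_on S (\<lambda>x. strain_kernel (f x) (g x))"
  unfolding strain_kernel_def tensor_def
  by (intro continuous_intros continuous_on_vec_lambda continuous_on_cross assms)

lemma borel_measurable_strain_kernel [measurable (raw)]: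
  assumes f: "f \<in> borel_measurable M" and g: "g \<in> borel_measurable M"
  shows "(\<lambda>x. strain_kernel (f x) (g x)) \<in> borel_measurable M"
  by (rule borel_measurable_continuous_Pair[OF f g])
     (intro continuous_on_strain_kernel continuous_intros)

text \<open>Allows the matrix form to be moved through integrals and limits.\<close>

lemma bounded_linear_matrix_form: "bounded_linear (\<lambda>A::real^3^3. (A *v p) \<bullet> q)"
  unfolding linear_conv_bounded_linear[symmetric]
  by (intro linearI) (simp_all add: matrix_vector_mult_add_rdistrib inner_add_left
       scaleR_matrix_vector_assoc[symmetric])

lemma strain_kernel_form_le:
  assumes s: "norm s \<le> 1"
  shows "\<bar>(strain_kernel s a *v p) \<bullet> p\<bar> \<le> (norm p)\<^sup>2 * (norm (sgn p - sgn a) * norm a)"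
proof -
  define e where "e = sgn a - sgn p"
  \<comment> \<open>Since \<open>sgn 0 = 0\<close>, both polar decompositions also hold for zero
    vectors.\<close>
  have a: "a = norm a *\<^sub>R sgn a" and p: "p = norm p *\<^sub>R sgn p"
    by (cases "a = 0"; cases "p = 0"; simp add: sgn_div_norm)+
  have "cross3 s a \<bullet> p = norm a * (cross3 s (sgn a) \<bullet> p)"
    by (subst a) (simp add: cross_mult_right)
  also have "cross3 s (sgn a) \<bullet> p = cross3 s e \<bullet> p"
  proof -
    have "cross3 s (sgn p) \<bullet> p = 0"
      by (subst (2) p) (simp add: dot_cross_self)
    then show ?thesis by (simp add: e_def Cross3.right_diff_distrib inner_diff_left)
  qed
  also have "cross3 s e \<bullet> p = cross3 p s \<bullet> e"
    by (simp add: cross3_simps)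
  finally have eq: "(strain_kernel s a *v p) \<bullet> p = norm a * (2 * (s \<bullet> p) * (cross3 p s \<bullet> e))"
    by (simp add: strain_kernel_form)
  have "\<bar>2 * (s \<bullet> p) * (cross3 p s \<bullet> e)\<bar> \<le> 2 * \<bar>s \<bullet> p\<bar> * (norm (cross3 p s) * norm e)"
    unfolding abs_mult by (intro mult_mono Cauchy_Schwarz_ineq2) auto
  also have "\<dots> = (2 * \<bar>s \<bullet> p\<bar> * norm (cross3 p s)) * norm e" by simp
  also have "\<dots> \<le> (norm p)\<^sup>2 * norm e"
  proof (rule mult_right_mono)
    have "2 * \<bar>s \<bullet> p\<bar> * norm (cross3 p s) \<le> \<bar>s \<bullet> p\<bar>\<^sup>2 + (norm (cross3 p s))\<^sup>2"
      by (rule sum_squares_bound)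
    \<comment> \<open>Lagrange's identity for \<open>p\<close> and \<open>s\<close>.\<close>
    also have "\<dots> = (norm p)\<^sup>2 * (norm s)\<^sup>2"
      using norm_cross_dot[of p s] by (simp add: inner_commute power_mult_distrib)
    also have "\<dots> \<le> (norm p)\<^sup>2 * 1"
      using s by (intro mult_left_mono power_le_one) auto
    finally show "2 * \<bar>s \<bullet> p\<bar> * norm (cross3 p s) \<le> (norm p)\<^sup>2" by simp
  qed simp
  finally have "\<bar>2 * (s \<bullet> p) * (cross3 p s \<bullet> e)\<bar> \<le> (norm p)\<^sup>2 * norm e" .
  then have "norm a * \<bar>2 * (s \<bullet> p) * (cross3 p s \<bullet> e)\<bar> \<le> norm a * ((norm p)\<^sup>2 * norm e)"
    by (rule mult_left_mono) simp
  then show ?thesis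
    unfolding eq by (simp add: abs_mult e_def norm_minus_commute ac_simps)
qed

section \<open>Cancellation on spheres and existence of the principal value\<close>

text \<open>For each \<open>p\<close> a reflection shows that the quadratic form of the integral
  vanishes at \<open>p\<close>. The integral is a symmetric matrix, so polarization makes it
  zero.\<close>

lemma integral_radial_strain_kernel:
  assumes int: "integrable lborel (\<lambda>z. g z *\<^sub>R strain_kernel (sgn z) a)"
    and radial: "\<And>y z. norm y = norm z \<Longrightarrow> g y = g z"
  shows "(\<integral>z. g z *\<^sub>R strain_kernel (sgn z) a \<partial>lborel) = 0"
proof -
  define A where "A = (\<integral>z. g z *\<^sub>R strain_kernel (sgn z) a \<partial>lborel)"
  have form: "(A *v p) \<bullet> q = (\<integral>z. ((g z *\<^sub>R strain_kernel (sgn z) a) *v p) \<bullet> q \<partial>lborel)" for p q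
    unfolding A_def by (rule integral_bounded_linear[OF bounded_linear_matrix_form int, symmetric])
  \<comment> \<open>The reflection \<open>T\<close> in the plane orthogonal to \<open>n = a \<times> p\<close> fixes \<open>p\<close> and flips the sign of the
    integrand \<open>2 g(z) (sgn z \<bullet> p) (sgn z \<bullet> n)\<close>.\<close>
  have Q: "(A *v p) \<bullet> p = 0" for p
  proof -
    define n where "n = cross3 a p"
    \<comment> \<open>If \<open>n = 0\<close>, division by zero gives 0 and \<open>T\<close> is the
      identity; the sign rule then holds because the integrand is 0.\<close>
    define T where "T z = z - (2 * (z \<bullet> n) / (n \<bullet> n)) *\<^sub>R n" for z
    have "linear T"
      unfolding T_def
      by (intro linearI) (simp_all add: inner_add_left add_divide_distrib distrib_left scaleR_add_left scaleR_diff_right)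
    have norm_T: "norm (T z) = norm z" for z
    proof (cases "n = 0")
      case False
      have "T z \<bullet> T z = z \<bullet> z - 2 * (2 * (z \<bullet> n) / (n \<bullet> n)) * (z \<bullet> n)
          + (2 * (z \<bullet> n) / (n \<bullet> n)) * (2 * (z \<bullet> n) / (n \<bullet> n)) * (n \<bullet> n)"
        by (simp add: T_def inner_diff_left inner_diff_right inner_commute[of n z])
      also have "\<dots> = z \<bullet> z" using False by simp
      finally show ?thesis by (simp add: norm_eq)
    qed (simp add: T_def)
    have T: "orthogonal_transformation T"
      using \<open>linear T\<close> norm_T by (simp add: orthogonal_transformation)
    have Tm: "T \<in> borel_measurable lborel"
      unfolding T_def by measurable
    have np: "n \<bullet> p = 0" by (simp add: n_def dot_cross_self)
    define f where "f z = ((g z *\<^sub>R strain_kernel (sgn z) a) *v p) \<bullet> p" for z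
    have f: "f z = g z * (2 * (sgn z \<bullet> p) * (sgn z \<bullet> n))" for z
    proof -
      have "cross3 (sgn z) a \<bullet> p = sgn z \<bullet> n" unfolding n_def by (simp add: cross3_simps)
      then show ?thesis
        by (simp add: f_def strain_kernel_form scaleR_matrix_vector_assoc[symmetric])
    qed
    have "f (T z) = - f z" for z
    proof -
      have "T z \<bullet> p = z \<bullet> p" by (simp add: T_def inner_diff_left np)
      moreover have "T z \<bullet> n = - (z \<bullet> n)" by (cases "n = 0") (simp_all add: T_def inner_diff_left)
      ultimately show ?thesis
        using radial[OF norm_T[of z]] by (simp add: f sgn_div_norm norm_T)
    qed
    have "f \<in> borel_measurable lborel"
      unfolding f_def[abs_def]
      using borel_measurable_integrable[OF integrable_bounded_linear[OF bounded_linear_matrix_form int]] .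
    then have "(\<integral>z. f (T z) \<partial>lborel) = (\<integral>z. f z \<partial>lborel)"
      using integral_distr[OF Tm, of f] distr_lborel_orthogonal[OF T] Tm by simp
    then have "(\<integral>z. f z \<partial>lborel) = 0"
      by (simp add: \<open>\<And>z. f (T z) = - f z\<close>)
    then show ?thesis by (simp add: form f_def)
  qed
  have sym: "(A *v p) \<bullet> q = (A *v q) \<bullet> p" for p q
    unfolding form
    by (simp add: scaleR_matrix_vector_assoc[symmetric] strain_kernel_form algebra_simps)
  have "(A *v p) \<bullet> q = 0" for p q
    using Q[of "p + q"] Q[of p] Q[of q] sym[of p q]
    by (simp add: matrix_vector_right_distrib inner_add_left inner_add_right)
  then have "A *v p = 0" for p by (metis inner_eq_zero_iff)
  then have "A = 0" by (metis matrix_eq matrix_vector_mult_0)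
  then show ?thesis by (simp add: A_def)
qed

text \<open>Near \<open>x\<close> the derivative gives a linear bound. For
  \<open>norm z >= d\<close> a bound \<open>M\<close> from compactness is at most
  \<open>M / d * norm z\<close>. The gained factor \<open>norm z\<close> tames the cubic singularity
  of the kernel.\<close>

lemma differentiable_diff_le:
  fixes w :: "'a::euclidean_space \<Rightarrow> 'b::real_normed_vector"
  assumes w: "w differentiable (at x)" and cont: "continuous_on UNIV w"
  obtains B where "0 \<le> B" "\<And>z. norm z \<le> R \<Longrightarrow> norm (w (x - z) - w x) \<le> B * norm z"
proof -
  obtain D where D: "(w has_derivative D) (at x)" using w by (auto simp: differentiable_def)
  then have "bounded_linear D" by (rule has_derivative_bounded_linear)
  then obtain K where K: "\<And>h. norm (D h) \<le> norm h * K" "K \<ge> 0"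
    using bounded_linear.nonneg_bounded by blast
  obtain d where d: "d > 0" "\<And>y. norm (y - x) < d \<Longrightarrow> norm (w y - w x - D (y - x)) \<le> 1 * norm (y - x)"
    using D unfolding has_derivative_at_alt by (meson zero_less_one)
  have "compact ((\<lambda>z. w (x - z) - w x) ` cball 0 R)"
    by (intro compact_continuous_image continuous_intros continuous_on_compose2[OF cont]) auto
  then obtain M where M: "\<And>z. norm z \<le> R \<Longrightarrow> norm (w (x - z) - w x) \<le> M"
    by (force simp: bounded_iff dest: compact_imp_bounded)
  show thesis
  proof (rule that[of "max (K + 1) (\<bar>M\<bar> / d)"])
    fix z :: 'a assume z: "norm z \<le> R"
    show "norm (w (x - z) - w x) \<le> max (K + 1) (\<bar>M\<bar> / d) * norm z"
    proof (cases "norm z < d")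
      case True
      have "norm (w (x - z) - w x) \<le> norm (w (x - z) - w x - D (- z)) + norm (D (- z))"
        using norm_triangle_ineq[of "w (x - z) - w x - D (- z)" "D (- z)"] by simp
      also have "\<dots> \<le> norm z + norm z * K"
        using d(2)[of "x - z"] K(1)[of "- z"] True by simp
      also have "\<dots> = (K + 1) * norm z" by (simp add: algebra_simps)
      also have "\<dots> \<le> max (K + 1) (\<bar>M\<bar> / d) * norm z" by (intro mult_right_mono) auto
      finally show ?thesis .
    next
      case False
      have "norm (w (x - z) - w x) \<le> \<bar>M\<bar> / d * d" using M[OF z] d(1) by simp
      also have "\<dots> \<le> max (K + 1) (\<bar>M\<bar> / d) * norm z"
        using False d(1) by (intro mult_mono) (auto simp: le_max_iff_disj)
      finally show ?thesis .
    qed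
  qed (use K in auto)
qed

text \<open>For every \<open>\<delta>\<close> the contribution of the constant \<open>w x\<close>
  integrates to zero, so the truncations are those of the absolutely integrable \<open>h\<close>,
  and dominated convergence applies. Integrability of the truncations is exported as well, so that
  the matrix form can be taken inside them.\<close>

lemma near_strain_tendsto:
  fixes w :: "real^3 \<Rightarrow> real^3" and x :: "real^3"
  assumes w: "\<And>x. w differentiable (at x)"
    and \<theta>: "continuous_on UNIV \<theta>" "\<And>x y. norm x = norm y \<Longrightarrow> \<theta> x = \<theta> y"
      "\<And>x. 0 \<le> \<theta> x" "\<And>x. \<theta> x \<le> 1" "\<And>x. 1 < norm x \<Longrightarrow> \<theta> x = 0"
    and R: "0 < R"
  defines "I \<equiv> \<lambda>\<delta>::real. \<integral>z\<in>{z. \<delta> < norm z}.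
     (\<theta> (z /\<^sub>R R) / norm z ^ 3) *\<^sub>R strain_kernel (sgn z) (w (x - z)) \<partial>lborel"
  obtains L where "(I \<longlongrightarrow> L) (at_right 0)"
    "\<And>\<delta>. 0 < \<delta> \<Longrightarrow> set_integrable lborel {z. \<delta> < norm z}
       (\<lambda>z. (\<theta> (z /\<^sub>R R) / norm z ^ 3) *\<^sub>R strain_kernel (sgn z) (w (x - z)))"
proof -
  define k where "k z = \<theta> (z /\<^sub>R R) / norm z ^ 3" for z
  define h where "h z = k z *\<^sub>R strain_kernel (sgn z) (w (x - z) - w x)" for z
  have cont: "continuous_on UNIV w"
    using w by (simp add: continuous_at_imp_continuous_on differentiable_imp_continuous_within)
  have [measurable]: "w \<in> borel_measurable borel" "\<theta> \<in> borel_measurable borel"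
    using cont \<theta>(1) by (auto intro: borel_measurable_continuous_onI)
  have [measurable]: "(sgn :: real^3 \<Rightarrow> real^3) \<in> borel_measurable borel"
    unfolding sgn_div_norm[abs_def] by measurable
  have [measurable]: "k \<in> borel_measurable borel" unfolding k_def[abs_def] by measurable
  have k0: "0 \<le> k z" for z using \<theta>(3) by (simp add: k_def)
  have k: "k z \<le> indicator (cball 0 R) z / norm z ^ 3" for z
    using \<theta>(4,5)[of "z /\<^sub>R R"] R
    by (auto simp: k_def indicator_def field_simps divide_right_mono)
  have sgn: "norm (sgn z) \<le> 1" for z :: "real^3" by (simp add: norm_sgn)
  obtain B where B: "0 \<le> B" "\<And>z. norm z \<le> R \<Longrightarrow> norm (w (x - z) - w x) \<le> B * norm z"
    using differentiable_diff_le[OF w cont] by blast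
  have int_h: "integrable lborel h"
  proof (rule Bochner_Integration.integrable_bound)
    show "integrable lborel (\<lambda>z::real^3. (2 * B) * (indicator (cball 0 R) z / norm z ^ 2))"
      using R by (intro integrable_mult_right integrable_norm_power_cball) auto
    have "norm (h z) \<le> 2 * B * (indicator (cball 0 R) z / norm z ^ 2)" for z
    proof (cases "norm z \<le> R \<and> z \<noteq> 0")
      case True
      have "norm (h z) \<le> (1 / norm z ^ 3) * (2 * norm (w (x - z) - w x))"
        unfolding h_def norm_scaleR using k[of z] k0[of z] True
        by (intro mult_mono norm_strain_kernel_le sgn) auto
      also have "\<dots> \<le> (1 / norm z ^ 3) * (2 * (B * norm z))"
        using B(2) True by (intro mult_left_mono) auto
      also have "\<dots> = 2 * B * (indicator (cball 0 R) z / norm z ^ 2)"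
        using True by (simp add: power2_eq_square power3_eq_cube)
      finally show ?thesis .
    next
      case False
      \<comment> \<open>At the origin this is division by zero; outside the ball it is the
        cutoff.\<close>
      then have "k z = 0" using k[of z] k0[of z] by (auto simp: indicator_def k_def)
      then show ?thesis using B(1) by (simp add: h_def)
    qed
    from order_trans[OF this abs_ge_self] show "AE z in lborel. norm (h z) \<le> norm (2 * B * (indicator (cball 0 R) z / norm z ^ 2))"
      unfolding real_norm_def by (rule AE_I2)
  qed (unfold h_def[abs_def], measurable)
  \<comment> \<open>The constant part keeps the full cubic singularity and is integrable only after
    truncation, where the weight is at most \<open>1 / \<delta> ^ 3\<close>.\<close>
  have int_c: "integrable lborel (\<lambda>z. (indicator {z. \<delta> < norm z} z * k z) *\<^sub>R strain_kernel (sgn z) (w x))"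
    if "0 < \<delta>" for \<delta> :: real
  proof (rule Bochner_Integration.integrable_bound)
    show "integrable lborel (\<lambda>z::real^3. (2 * norm (w x) / \<delta> ^ 3) * indicator (cball 0 R) z)"
      by (intro integrable_mult_right integrable_real_indicator emeasure_lborel_cball_finite) auto
    have "norm ((indicator {z. \<delta> < norm z} z * k z) *\<^sub>R strain_kernel (sgn z) (w x))
        \<le> (2 * norm (w x) / \<delta> ^ 3) * indicator (cball 0 R) z" for z
    proof -
      have "\<bar>indicator {z. \<delta> < norm z} z * k z\<bar> \<le> indicator (cball 0 R) z / \<delta> ^ 3"
      proof (cases "\<delta> < norm z")
        case True
        have "k z \<le> indicator (cball 0 R) z / norm z ^ 3" by (rule k)
        also have "\<dots> \<le> indicator (cball 0 R) z / \<delta> ^ 3"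
          using True that by (intro divide_left_mono power_mono mult_pos_pos) auto
        finally show ?thesis using True k0[of z] by simp
      qed (use that in simp)
      then have "\<bar>indicator {z. \<delta> < norm z} z * k z\<bar> * norm (strain_kernel (sgn z) (w x))
        \<le> (indicator (cball 0 R) z / \<delta> ^ 3) * (2 * norm (w x))"
        by (intro mult_mono norm_strain_kernel_le sgn) (use that in auto)
      then show ?thesis by (simp add: algebra_simps)
    qed
    from order_trans[OF this abs_ge_self] show "AE z in lborel. norm ((indicator {z. \<delta> < norm z} z * k z) *\<^sub>R strain_kernel (sgn z) (w x))
        \<le> norm ((2 * norm (w x) / \<delta> ^ 3) * indicator (cball 0 R) z)"
      unfolding real_norm_def by (rule AE_I2)
  qed measurable
  \<comment> \<open>The truncated weight is still radial.\<close>
  have zero: "(\<integral>z. (indicator {z. \<delta> < norm z} z * k z) *\<^sub>R strain_kernel (sgn z) (w x) \<partial>lborel) = 0"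
    if "0 < \<delta>" for \<delta> :: real
    using \<theta>(2) R
    by (intro integral_radial_strain_kernel int_c that) (auto simp: indicator_def k_def)
  have split: "indicator {z. \<delta> < norm z} z *\<^sub>R (k z *\<^sub>R strain_kernel (sgn z) (w (x - z)))
     = indicator {z. \<delta> < norm z} z *\<^sub>R h z
       + (indicator {z. \<delta> < norm z} z * k z) *\<^sub>R strain_kernel (sgn z) (w x)" for \<delta> :: real and z
    by (simp add: h_def strain_kernel_diff algebra_simps)
  have int_ih: "integrable lborel (\<lambda>z. indicator {z. \<delta> < norm z} z *\<^sub>R h z)" for \<delta> :: real
    using int_h by (intro integrable_mult_indicator) measurable
  have si: "set_integrable lborel {z. \<delta> < norm z} (\<lambda>z. k z *\<^sub>R strain_kernel (sgn z) (w (x - z)))"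
    if "0 < \<delta>" for \<delta>
    unfolding set_integrable_def split by (intro Bochner_Integration.integrable_add int_ih int_c that)
  have I: "I \<delta> = (\<integral>z. indicator {z. \<delta> < norm z} z *\<^sub>R h z \<partial>lborel)" if "0 < \<delta>" for \<delta>
    unfolding I_def set_lebesgue_integral_def k_def[symmetric] split
    using int_ih int_c[OF that] zero[OF that] by simp
  have lim: "(I \<longlongrightarrow> (\<integral>z. h z \<partial>lborel)) (at_right 0)"
    \<comment> \<open>Dominated convergence is a statement about sequences, so the one-sided limit
      is tested along them.\<close>
    unfolding tendsto_at_iff_sequentially
  proof (intro allI impI)
    fix X :: "nat \<Rightarrow> real" assume X: "\<forall>i. X i \<in> {0<..} - {0}" "X \<longlonglongrightarrow> 0"
    have "(\<lambda>i. \<integral>z. indicator {z. X i < norm z} z *\<^sub>R h z \<partial>lborel) \<longlonglongrightarrow> (\<integral>z. h z \<partial>lborel)"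
    proof (rule integral_dominated_convergence[where w = "\<lambda>z. norm (h z)"])
      show "AE z in lborel. (\<lambda>i. indicator {z. X i < norm z} z *\<^sub>R h z) \<longlonglongrightarrow> h z"
      proof (rule AE_I2)
        fix z
        show "(\<lambda>i. indicator {z. X i < norm z} z *\<^sub>R h z) \<longlonglongrightarrow> h z"
        proof (cases "z = 0")
          case False
          then have "eventually (\<lambda>i. X i < norm z) sequentially"
            using order_tendstoD(2)[OF X(2), of "norm z"] by simp
          then have "eventually (\<lambda>i. indicator {z. X i < norm z} z *\<^sub>R h z = h z) sequentially"
            by eventually_elim simp
          then show ?thesis by (rule tendsto_eventually)
        qed (simp add: h_def k_def)
      qed
    qed (use int_h int_ih in \<open>auto simp: indicator_def\<close>)
    then show "(I \<circ> X) \<longlonglongrightarrow> (\<integral>z. h z \<partial>lborel)"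
      using X(1) by (simp add: o_def I)
  qed
  show thesis by (rule that[OF lim si[unfolded k_def]])
qed

section \<open>The pointwise bound and its integration over the cylinder\<close>

lemma near_strain_form_le_pair_integral:
  assumes w: "\<And>y. (\<lambda>x. w x t) differentiable (at y)"
    and \<theta>: "continuous_on UNIV \<theta>" "\<And>x y. norm x = norm y \<Longrightarrow> \<theta> x = \<theta> y"
      "\<And>x. 0 \<le> \<theta> x" "\<And>x. \<theta> x \<le> 1" "\<And>x. 1 < norm x \<Longrightarrow> \<theta> x = 0"
    and R: "0 < R"
  shows "ennreal (max 0 ((near_strain \<theta> R w x t *v w x t) \<bullet> w x t))
    \<le> ennreal (3 / (8 * pi)) * (ennreal ((norm (w x t))\<^sup>2) * pair_integral \<theta> R w (\<lambda>x t. sgn (w x t)) x t)"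
\<comment> \<open>Where \<open>w x t = 0\<close> both sides vanish; otherwise the factor
  \<open>(norm p)^2\<close> is positive, as \<open>nn_integral_cmult_le\<close> requires.\<close>
proof (cases "w x t = 0")
  case False
  define p where "p = w x t"
  define k where "k z = (\<theta> (z /\<^sub>R R) / norm z ^ 3) *\<^sub>R strain_kernel (sgn z) (w (x - z) t)" for z
  define I where "I = (\<lambda>\<delta>::real. \<integral>z\<in>{z. \<delta> < norm z}. k z \<partial>lborel)"
  define P where "P = pair_integral \<theta> R w (\<lambda>x t. sgn (w x t)) x t"
  obtain L where L: "(I \<longlongrightarrow> L) (at_right 0)"
    and si: "\<And>\<delta>. 0 < \<delta> \<Longrightarrow> set_integrable lborel {z. \<delta> < norm z} k"
    using near_strain_tendsto[OF w \<theta> R, of x] unfolding I_def k_def[abs_def] by blast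
  \<comment> \<open>Convergence identifies \<open>Lim\<close> in \<open>near_strain\<close> with the
    actual limit.\<close>
  have S: "near_strain \<theta> R w x t = (3 / (8 * pi)) *\<^sub>R L"
    unfolding near_strain_def strain_kernel_def[symmetric] k_def[symmetric] I_def[symmetric]
    by (subst tendsto_Lim[OF _ L]) auto
  \<comment> \<open>Each truncation is compared with the pair integral truncated at the same
    \<open>\<delta>\<close>, one member of the supremum, so the bound \<open>P\<close> is
    independent of \<open>\<delta>\<close> and survives the limit.\<close>
  have bound: "ennreal ((I \<delta> *v p) \<bullet> p) \<le> ennreal ((norm p)\<^sup>2) * P" if "0 < \<delta>" for \<delta>
  proof -
    let ?d = "\<lambda>z. \<theta> (z /\<^sub>R R) * (norm (sgn p - sgn (w (x - z) t)) * norm (w (x - z) t)) / norm z ^ 3"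
    let ?i = "\<lambda>z. indicator {z. \<delta> < norm z} z :: real"
    have int: "integrable lborel (\<lambda>z. ?i z *\<^sub>R k z)" using si[OF that] by (simp add: set_integrable_def)
    have "(I \<delta> *v p) \<bullet> p = (\<integral>z. ((?i z *\<^sub>R k z) *v p) \<bullet> p \<partial>lborel)"
      unfolding I_def set_lebesgue_integral_def
      by (rule integral_bounded_linear[OF bounded_linear_matrix_form int, symmetric])
    then have "ennreal ((I \<delta> *v p) \<bullet> p) \<le> ennreal (norm (\<integral>z. ((?i z *\<^sub>R k z) *v p) \<bullet> p \<partial>lborel))"
      by (simp add: ennreal_leI)
    also have "\<dots> \<le> (\<integral>\<^sup>+z. ennreal (norm (((?i z *\<^sub>R k z) *v p) \<bullet> p)) \<partial>lborel)"
      by (intro integral_norm_bound_ennreal integrable_bounded_linear[OF bounded_linear_matrix_form int])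
    also have "\<dots> \<le> (\<integral>\<^sup>+z. ennreal ((norm p)\<^sup>2) * (ennreal (?d z) * indicator {z. \<delta> < norm z} z) \<partial>lborel)"
    proof (rule nn_integral_mono)
      fix z
      have "norm ((k z *v p) \<bullet> p) = \<theta> (z /\<^sub>R R) / norm z ^ 3 * \<bar>(strain_kernel (sgn z) (w (x - z) t) *v p) \<bullet> p\<bar>"
        using \<theta>(3) by (simp add: k_def scaleR_matrix_vector_assoc[symmetric] abs_mult)
      also have "\<dots> \<le> \<theta> (z /\<^sub>R R) / norm z ^ 3 *
          ((norm p)\<^sup>2 * (norm (sgn p - sgn (w (x - z) t)) * norm (w (x - z) t)))"
        using \<theta>(3) by (intro mult_left_mono strain_kernel_form_le) (auto simp: norm_sgn)
      also have "\<dots> = (norm p)\<^sup>2 * ?d z" by simp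
      finally have "ennreal (norm ((k z *v p) \<bullet> p)) \<le> ennreal ((norm p)\<^sup>2) * ennreal (?d z)"
        using \<theta>(3) by (simp add: ennreal_leI flip: ennreal_mult)
      then show "ennreal (norm (((?i z *\<^sub>R k z) *v p) \<bullet> p))
          \<le> ennreal ((norm p)\<^sup>2) * (ennreal (?d z) * indicator {z. \<delta> < norm z} z)"
        by (auto simp: indicator_def)
    qed
    also have "\<dots> \<le> ennreal ((norm p)\<^sup>2) * (\<integral>\<^sup>+z. ennreal (?d z) * indicator {z. \<delta> < norm z} z \<partial>lborel)"
      using False by (intro nn_integral_cmult_le) (simp add: p_def)
    also have "\<dots> \<le> ennreal ((norm p)\<^sup>2) * P"
      unfolding P_def pair_integral_def p_def[symmetric] using that
      by (intro mult_left_mono SUP_upper2[of \<delta>]) auto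
    finally show ?thesis .
  qed
  have "((\<lambda>\<delta>. ennreal ((I \<delta> *v p) \<bullet> p)) \<longlongrightarrow> ennreal ((L *v p) \<bullet> p)) (at_right 0)"
    by (intro tendsto_ennrealI bounded_linear.tendsto[OF bounded_linear_matrix_form] L)
  then have "ennreal ((L *v p) \<bullet> p) \<le> ennreal ((norm p)\<^sup>2) * P"
    by (rule tendsto_upperbound) (auto intro!: eventually_at_rightI[of 0 1] bound)
  then have "ennreal (3 / (8 * pi)) * ennreal ((L *v p) \<bullet> p) \<le> ennreal (3 / (8 * pi)) * (ennreal ((norm p)\<^sup>2) * P)"
    by (rule mult_left_mono) simp
  then show ?thesis
    \<comment> \<open>\<open>ennreal\<close> sends negative reals to 0, which accounts for the
      positive part.\<close>
    unfolding S P_def p_def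
    by (simp add: scaleR_matrix_vector_assoc[symmetric] ennreal_max_0 flip: ennreal_mult')
qed simp

text \<open>A null set of times, multiplied by all of space, is null in space-time. This turns
  regularity at almost every time into a property of almost every space-time point.\<close>

lemma AE_lborel_snd:
  assumes "AE t in lborel. P t"
  shows "AE p in (lborel :: ('a::euclidean_space \<times> 'b::euclidean_space) measure). P (snd p)"
proof -
  obtain N where N: "{t. \<not> P t} \<subseteq> N" "N \<in> null_sets (lborel :: 'b measure)"
    using assms by (auto simp: eventually_ae_filter)
  then have "UNIV \<times> N \<in> null_sets (lborel \<Otimes>\<^sub>M lborel :: ('a \<times> 'b) measure)"
    by (auto simp: null_sets_def lborel.emeasure_pair_measure_Times)
  then have "UNIV \<times> N \<in> null_sets (lborel :: ('a \<times> 'b) measure)"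
    by (simp only: lborel_prod)
  then show ?thesis
    by (rule AE_I') (use N(1) in auto)
qed

theorem theorem2p1:
  fixes x0 :: "real^3" and t0 r \<rho> l :: real
    and \<phi> \<theta> :: "real^3 \<Rightarrow> real"
    and u :: "real^3 \<Rightarrow> real \<Rightarrow> real^3"
    and chi :: "(real^3) \<times> real \<Rightarrow> real"
  assumes filter: "test_function \<phi> (ball 0 1)" "\<forall>x. 0 \<le> \<phi> x" "(\<integral>x. \<phi> x \<partial>lborel) = 1"
    and cutoff: "test_function \<theta> (ball 0 1)" "\<forall>x y. norm x = norm y \<longrightarrow> \<theta> x = \<theta> y"
      "\<forall>x. 0 \<le> \<theta> x \<and> \<theta> x \<le> 1" "\<forall>x\<in>ball 0 (1/2). \<theta> x = 1"
    and params: "0 < r" "0 < \<rho>" "\<rho> \<le> 1/4" "0 < l" "l \<le> \<rho> * r"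
    and velocity: "Linf_L2 {t0 - r\<^sup>2 <..< t0} u"
      "AE t in lebesgue_on {t0 - r\<^sup>2 <..< t0}. weakly_div_free (\<lambda>x. u x t)"
    and weight: "test_function chi (parabolic_cylinder x0 t0 r)" "\<forall>p. 0 \<le> chi p \<and> chi p \<le> 1"
  shows "near_stretching_pos \<theta> \<rho> x0 t0 r (filtered_vorticity \<phi> l u) chi
         \<le> ennreal (3 / (8 * pi)) *
           pair_defect \<theta> \<rho> x0 t0 r (filtered_vorticity \<phi> l u) (filtered_direction \<phi> l u) chi"
proof -
  define w where "w = filtered_vorticity \<phi> l u"
  define R where "R = \<rho> * r"
  define c where "c = 3 / (8 * pi)"
  have "0 < R" using params by (simp add: R_def)
  have "0 < c" by (simp add: c_def)
  have C1: "C_k (Suc 0) \<theta>" using cutoff(1) unfolding test_function_def C_infinity_def by blast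
  then have cont: "continuous_on UNIV \<theta>"
    by (simp add: continuous_at_imp_continuous_on differentiable_imp_continuous_within)
  have supp: "\<theta> x = 0" if "1 < norm x" for x
    using cutoff(1) closure_subset[of "{x. \<theta> x \<noteq> 0}"] that unfolding test_function_def by force
  let ?I = "{t0 - r\<^sup>2 <..< t0}"
  define S where "S x t = max 0 ((near_strain \<theta> R w x t *v w x t) \<bullet> w x t)" for x t
  define P where "P x t = pair_integral \<theta> R w (\<lambda>x t. sgn (w x t)) x t" for x t
  have \<xi>: "filtered_direction \<phi> l u = (\<lambda>x t. sgn (w x t))"
    by (simp add: fun_eq_iff filtered_direction_def w_def)
  obtain B where "AE t in lebesgue_on ?I. (\<lambda>x. u x t) \<in> borel_measurable lebesgue \<and>
      (\<integral>\<^sup>+ x. ennreal ((norm (u x t))\<^sup>2) \<partial>lebesgue) \<le> ennreal (B\<^sup>2)"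
    using velocity(1) unfolding Linf_L2_def by blast
  then have "AE t in lebesgue_on ?I. \<forall>y. (\<lambda>x. w x t) differentiable (at y)"
  proof eventually_elim
    case (elim t)
    then have "(\<integral>\<^sup>+ x. ennreal ((norm (u x t))\<^sup>2) \<partial>lebesgue) < \<infinity>"
      by (auto intro: le_less_trans[OF _ ennreal_less_top])
    then show ?case
      unfolding w_def using elim filter(1) params(4)
      by (intro allI differentiable_filtered_vorticity square_integrable_imp_integrable_cball) auto
  qed
  \<comment> \<open>The exceptional times are moved to \<open>lborel\<close>, the measure of the
    space-time integrals.\<close>
  then have "AE t in lborel. t \<in> ?I \<longrightarrow> (\<forall>y. (\<lambda>x. w x t) differentiable (at y))"
    by (subst (asm) AE_restrict_space_iff) (auto simp: AE_completion_iff)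
  then have good: "AE p in lborel. snd p \<in> ?I \<longrightarrow> (\<forall>y. (\<lambda>x. w x (snd p)) differentiable (at y))"
    by (rule AE_lborel_snd)
  let ?G = "\<lambda>p. (case p of (x, t) \<Rightarrow> ennreal (chi (x, t) * (norm (w x t))\<^sup>2) * P x t)
      * indicator (parabolic_cylinder x0 t0 r) p"
  have "(\<integral>\<^sup>+ (x, t) \<in> parabolic_cylinder x0 t0 r. ennreal (chi (x, t) * S x t) \<partial>lborel)
      \<le> (\<integral>\<^sup>+ p. ennreal c * ?G p \<partial>lborel)"
  proof (rule nn_integral_mono_AE, use good in eventually_elim)
    case (elim p)
    obtain x t where p: "p = (x, t)" by (cases p)
    show ?case
    proof (cases "p \<in> parabolic_cylinder x0 t0 r")
      case True
      then have diff: "\<And>y. (\<lambda>x. w x t) differentiable (at y)"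
        using elim by (simp add: p parabolic_cylinder_def)
      have "0 \<le> S x t" by (simp add: S_def)
      from diff have "ennreal (S x t) \<le> ennreal c * (ennreal ((norm (w x t))\<^sup>2) * P x t)"
        unfolding S_def P_def c_def
        by (rule near_strain_form_le_pair_integral) (use cutoff cont supp \<open>0 < R\<close> in blast)+
      \<comment> \<open>Since \<open>chi\<close> and \<open>S\<close> are nonnegative,
        \<open>ennreal\<close> splits their product, so the pointwise bound carries over to the
        weighted integrands.\<close>
      then have "ennreal (chi p) * ennreal (S x t)
          \<le> ennreal (chi p) * (ennreal c * (ennreal ((norm (w x t))\<^sup>2) * P x t))"
        by (rule mult_left_mono) simp
      then show ?thesis
        using True weight(2) \<open>0 \<le> S x t\<close> by (simp add: p ennreal_mult ac_simps)
    qed simp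
  qed
  also have "\<dots> \<le> ennreal c * (\<integral>\<^sup>+ p. ?G p \<partial>lborel)"
    using \<open>0 < c\<close> by (rule nn_integral_cmult_le)
  finally have "ennreal r * (\<integral>\<^sup>+ (x, t) \<in> parabolic_cylinder x0 t0 r. ennreal (chi (x, t) * S x t) \<partial>lborel)
      \<le> ennreal r * (ennreal c * (\<integral>\<^sup>+ p. ?G p \<partial>lborel))"
    by (rule mult_left_mono) simp
  then show ?thesis
    unfolding near_stretching_pos_def pair_defect_def \<xi> w_def[symmetric] R_def[symmetric] c_def[symmetric]
      S_def P_def
    by (simp only: mult.left_commute)
qed

end
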